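(* Let $A,B,H,K$ be logically independent events. The family $\{A|H,\ (B|K)|_i(A|H)\}$ is p-consistent for every $i\in\{C,dF,F,K,L,gs\}$, and the generalized Modus Ponens from the premise set $\{A|H,\ (B|K)|_i(A|H)\}$ to the conclusion $B|K$ satisfies $$\{A|H,\ (B|K)|_i(A|H)\}\Rightarrow_p B|K\quad\text{for } i\in\{K,L,gs\},$$ $$\{A|H,\ (B|K)|_i(A|H)\}\not\Rightarrow_p B|K\quad\text{for } i\in\{C,dF,F\}.$$
   Context: Events are two-valued entities identified with their indicators (values $1/0$); $\emptyset$ is the impossible event, $AB=A\wedge B$, $\overline{A}$ is the negation. Four events are logically independent if all $16$ conjunctions obtained by taking each event or its negation are different from $\emptyset$. For $H\neq\emptyset$ the conditional event $E|H$ is true if $EH$ is true, false if $\overline{E}H$ is true, void if $\overline{H}$ is true. Once $P(E|H)=p$ is assessed, $E|H$ is also the random quantity $EH+p\overline{H}$; numerically $\overline{A}|H=1-A|H$. Subscripts such as $K$ on operations are only names, unrelated to the events. Iterated conditionals that are conditional events: $(B|K)|_{C}(A|H)=B|(K\wedge(\overline{H}\vee A))$; $(B|K)|_{dF}(A|H)=B|(AHK)$; $(B|K)|_{F}(A|H)=AHBK|(AHBK\vee AH\overline{B}K\vee\overline{H}\,\overline{B}K)$. Conjunctions, with $x=P(A|H)$, $y=P(B|K)$: $(A|H)\wedge_K(B|K)=AHBK|(HK\vee\overline{A}H\vee\overline{B}K)$; $(A|H)\wedge_L(B|K)=AHBK|(AHBK\vee\overline{A}H\vee\overline{B}K\vee\overline{H}\,\overline{K})$;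 $(A|H)\wedge_{gs}(B|K)=(AHBK+x\overline{H}BK+yAH\overline{K})|(H\vee K)$, i.e. the conditional random quantity equal to $AHBK+x\overline{H}BK+yAH\overline{K}$ if $H\vee K$ is true and to its own prevision $z_{gs}$ if $\overline{H}\,\overline{K}$ is true (bet called off). For $i\in\{K,L,gs\}$, $(B|K)|_i(A|H)$ is the random quantity $(A|H)\wedge_i(B|K)+\mu_i(\overline{A}|H)$, where $\mu_i=\mathbb{P}[(B|K)|_i(A|H)]$ is its assessed prevision (the amount paid to receive it). Coherence: an assessment of real values $m_j$ on a finite family of such objects $X_j$ is coherent iff for every nonempty subfamily $J$ and all reals $s_j$, the random gain $\sum_{j\in J}s_j(X_j-m_j)$, restricted to the cases where at least one of the bets in $J$ is not called off, has minimum $\le 0$ and maximum $\ge 0$. A bet on a conditional event is called off when it is void; a bet on an iterated conditional with $i\in\{K,L,gs\}$ is called off in the cases where one receives back the paid amount $\mu_i$ whatever it is (taking into account the relation $z_i=x\mu_i$, with $z_i=\mathbb{P}[(A|H)\wedge_i(B|K)]$, required by linearity of coherent previsions). For a family containing such an iterated conditional, an assessment is coherent iff it extends to a coherent assessment on the family enlarged with $A|H$, $B|K$ and $(A|H)\wedge_i(B|K)$. A finite family $\mathcal{F}$ of (conditional) random quantities with values in a finite subset of $[0,1]$ is p-consistent if the assessment $(1,\dots,1)$ on $\mathcal{F}$ is coherent. A p-consistent $\mathcal{F}=\{X_1,\dots,X_n\}$ p-entails $X$ (written $\mathcal{F}\Rightarrow_p X$) iff for every coherent assessment $(\mu_1,\dots,\mu_n,z)$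 on $\mathcal{F}\cup\{X\}$: $\mu_1=\dots=\mu_n=1$ implies $z=1$. *)

theory Defs
  imports Complex_Main "HOL-Library.Indicator_Function"
begin

text \<open>
  Events are subsets of a space \<open>'w\<close> of cases; the impossible event is \<open>{}\<close> and negation is
  complement.
\<close>

definition logically_independent :: "'w set \<Rightarrow> 'w set \<Rightarrow> 'w set \<Rightarrow> 'w set \<Rightarrow> bool" where
  "logically_independent A B H K \<longleftrightarrow>
     (\<forall>A' \<in> {A, - A}. \<forall>B' \<in> {B, - B}. \<forall>H' \<in> {H, - H}. \<forall>K' \<in> {K, - K}.
        A' \<inter> B' \<inter> H' \<inter> K' \<noteq> {})"

datatype conj_index = Conj_K | Conj_L | Conj_gs

text \<open>
  The objects on which previsions are assessed are kept symbolic, because their numerical values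
  depend on the assessment itself: \<open>CondEvent E H\<close> is $E|H$ (meant for \<open>H \<noteq> {}\<close>),
  \<open>ConjGS A H B K\<close> is $(A|H) \wedge_{gs} (B|K)$ and \<open>Iter i A H B K\<close> is $(B|K)|_i(A|H)$ for the
  three indices \<open>i\<close> whose iterated conditional is built from a conjunction.
\<close>

datatype 'w crq =
    CondEvent "'w set" "'w set"
  | ConjGS "'w set" "'w set" "'w set" "'w set"
  | Iter conj_index "'w set" "'w set" "'w set" "'w set"

definition conj_cond_K :: "'w set \<Rightarrow> 'w set \<Rightarrow> 'w set \<Rightarrow> 'w set \<Rightarrow> 'w set" where
  "conj_cond_K A H B K = (H \<inter> K) \<union> (- A \<inter> H) \<union> (- B \<inter> K)"

definition conj_cond_L :: "'w set \<Rightarrow> 'w set \<Rightarrow> 'w set \<Rightarrow> 'w set \<Rightarrow> 'w set" where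
  "conj_cond_L A H B K =
     (A \<inter> H \<inter> B \<inter> K) \<union> (- A \<inter> H) \<union> (- B \<inter> K) \<union> (- H \<inter> - K)"

text \<open>\<open>cond_conj i A H B K\<close> is $(A|H) \wedge_i (B|K)$.\<close>

fun cond_conj :: "conj_index \<Rightarrow> 'w set \<Rightarrow> 'w set \<Rightarrow> 'w set \<Rightarrow> 'w set \<Rightarrow> 'w crq" where
  "cond_conj Conj_K A H B K = CondEvent (A \<inter> H \<inter> B \<inter> K) (conj_cond_K A H B K)"
| "cond_conj Conj_L A H B K = CondEvent (A \<inter> H \<inter> B \<inter> K) (conj_cond_L A H B K)"
| "cond_conj Conj_gs A H B K = ConjGS A H B K"

text \<open>\<open>iterated i A H B K\<close> is $(B|K)|_i(A|H)$ for all six indices.\<close>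

datatype iter_index = It_C | It_dF | It_F | It_K | It_L | It_gs

fun iterated :: "iter_index \<Rightarrow> 'w set \<Rightarrow> 'w set \<Rightarrow> 'w set \<Rightarrow> 'w set \<Rightarrow> 'w crq" where
  "iterated It_C A H B K = CondEvent B (K \<inter> (- H \<union> A))"
| "iterated It_dF A H B K = CondEvent B (A \<inter> H \<inter> K)"
| "iterated It_F A H B K = CondEvent (A \<inter> H \<inter> B \<inter> K)
     ((A \<inter> H \<inter> B \<inter> K) \<union> (A \<inter> H \<inter> - B \<inter> K) \<union> (- H \<inter> - B \<inter> K))"
| "iterated It_K A H B K = Iter Conj_K A H B K"
| "iterated It_L A H B K = Iter Conj_L A H B K"
| "iterated It_gs A H B K = Iter Conj_gs A H B K"

text \<open>
  Numerical values. Here \<open>x\<close>, \<open>y\<close>, \<open>z\<close> and \<open>m\<close> are the previsions of $A|H$, $B|K$, of their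
  conjunction and of their iterated conditional.
\<close>

definition cond_val :: "'w set \<Rightarrow> 'w set \<Rightarrow> real \<Rightarrow> 'w \<Rightarrow> real" where
  "cond_val E H p w = indicator (E \<inter> H) w + p * indicator (- H) w"

definition gs_val ::
  "'w set \<Rightarrow> 'w set \<Rightarrow> 'w set \<Rightarrow> 'w set \<Rightarrow> real \<Rightarrow> real \<Rightarrow> real \<Rightarrow> 'w \<Rightarrow> real" where
  "gs_val A H B K x y z w =
     (if w \<in> H \<union> K
      then indicator (A \<inter> H \<inter> B \<inter> K) w + x * indicator (- H \<inter> B \<inter> K) w
             + y * indicator (A \<inter> H \<inter> - K) w
      else z)"

fun conj_val :: "conj_index \<Rightarrow> 'w set \<Rightarrow> 'w set \<Rightarrow> 'w set \<Rightarrow> 'w set \<Rightarrow>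
    real \<Rightarrow> real \<Rightarrow> real \<Rightarrow> 'w \<Rightarrow> real" where
  "conj_val Conj_K A H B K x y z w = cond_val (A \<inter> H \<inter> B \<inter> K) (conj_cond_K A H B K) z w"
| "conj_val Conj_L A H B K x y z w = cond_val (A \<inter> H \<inter> B \<inter> K) (conj_cond_L A H B K) z w"
| "conj_val Conj_gs A H B K x y z w = gs_val A H B K x y z w"

definition iter_val :: "conj_index \<Rightarrow> 'w set \<Rightarrow> 'w set \<Rightarrow> 'w set \<Rightarrow> 'w set \<Rightarrow>
    real \<Rightarrow> real \<Rightarrow> real \<Rightarrow> real \<Rightarrow> 'w \<Rightarrow> real" where
  "iter_val i A H B K x y z m w = conj_val i A H B K x y z w + m * (1 - cond_val A H x w)"

fun crq_val :: "('w crq \<Rightarrow> real) \<Rightarrow> 'w crq \<Rightarrow> 'w \<Rightarrow> real" where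
  "crq_val P (CondEvent E H) w = cond_val E H (P (CondEvent E H)) w"
| "crq_val P (ConjGS A H B K) w =
     gs_val A H B K (P (CondEvent A H)) (P (CondEvent B K)) (P (ConjGS A H B K)) w"
| "crq_val P (Iter i A H B K) w =
     iter_val i A H B K (P (CondEvent A H)) (P (CondEvent B K)) (P (cond_conj i A H B K))
       (P (Iter i A H B K)) w"

text \<open>
  For an iterated conditional the bet is called off in the cases where the amount paid is received
  back whatever that amount \<open>m\<close> is, the prevision of the conjunction being tied to it by
  $z = x m$. Which cases these are depends on \<open>x\<close>.
\<close>

fun called_off :: "('w crq \<Rightarrow> real) \<Rightarrow> 'w crq \<Rightarrow> 'w \<Rightarrow> bool" where
  "called_off P (CondEvent E H) w \<longleftrightarrow> w \<notin> H"
| "called_off P (ConjGS A H B K) w \<longleftrightarrow> w \<notin> H \<union> K"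
| "called_off P (Iter i A H B K) w \<longleftrightarrow>
     (\<forall>m. iter_val i A H B K (P (CondEvent A H)) (P (CondEvent B K)) (P (CondEvent A H) * m) m w
            = m)"

definition gain :: "('w crq \<Rightarrow> real) \<Rightarrow> 'w crq set \<Rightarrow> ('w crq \<Rightarrow> real) \<Rightarrow> 'w \<Rightarrow> real" where
  "gain P J s w = (\<Sum>X\<in>J. s X * (crq_val P X w - P X))"

definition active :: "('w crq \<Rightarrow> real) \<Rightarrow> 'w crq set \<Rightarrow> 'w set" where
  "active P J = {w. \<exists>X\<in>J. \<not> called_off P X w}"

text \<open>
  The gain takes finitely many values even if \<open>'w\<close> is infinite, so minimum and maximum exist
  whenever \<open>active P J\<close> is nonempty.
\<close>

definition betting_coherent :: "'w crq set \<Rightarrow> ('w crq \<Rightarrow> real) \<Rightarrow> bool" where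
  "betting_coherent F P \<longleftrightarrow>
     (\<forall>J s. J \<subseteq> F \<longrightarrow> J \<noteq> {} \<longrightarrow>
        Min (gain P J s ` active P J) \<le> 0 \<and> Max (gain P J s ` active P J) \<ge> 0)"

text \<open>The objects whose previsions enter the values of a given one.\<close>

fun constituents :: "'w crq \<Rightarrow> 'w crq set" where
  "constituents (CondEvent E H) = {}"
| "constituents (ConjGS A H B K) = {CondEvent A H, CondEvent B K}"
| "constituents (Iter i A H B K) = {CondEvent A H, CondEvent B K, cond_conj i A H B K}"

text \<open>Only the values of \<open>P\<close> on \<open>F\<close> matter in \<open>coherent F P\<close>.\<close>

definition coherent :: "'w crq set \<Rightarrow> ('w crq \<Rightarrow> real) \<Rightarrow> bool" where
  "coherent F P \<longleftrightarrow> finite F \<and>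
     (\<exists>Q. (\<forall>X\<in>F. Q X = P X) \<and> betting_coherent (F \<union> (\<Union>X\<in>F. constituents X)) Q)"

definition p_consistent :: "'w crq set \<Rightarrow> bool" where
  "p_consistent F \<longleftrightarrow> coherent F (\<lambda>_. 1)"

definition p_entails :: "'w crq set \<Rightarrow> 'w crq \<Rightarrow> bool" where
  "p_entails F X \<longleftrightarrow> p_consistent F \<and>
     (\<forall>P. coherent (F \<union> {X}) P \<longrightarrow> (\<forall>Y\<in>F. P Y = 1) \<longrightarrow> P X = 1)"

end

theory Submission
  imports Defs
begin

text \<open>
  Write $x$, $y$, $z$, $m$ for the previsions of $A|H$, $B|K$, of their conjunction and of the
  iterated conditional.

  Consistency holds because in the case $AHBK$ every object in question is worth 1: with all
  previsions equal to 1 every gain vanishes there, and no bet is called off there.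

  For the indices \<open>K\<close>, \<open>L\<close>, \<open>gs\<close>, a suitable combination of bets on $A|H$, on the
  iterated conditional and on the conjunction has the constant gain $z - xm$, so $z = xm$
  (\<open>conj_prevision_eq_product\<close>). Hence $x = m = 1$ forces $z = 1$. A conjunction of prevision 1
  forces its conjunct $B|K$ to have prevision 1
  (\<open>prevision_conjunct_eq_1\<close>): if $y < 1$, buying $B|K$ and selling enough of the conjunction wins
  in all cases where one of the two bets is on, since a case in which the conjunction is worth 1
  or is called off, and $B|K$ is not worth 1, calls off both bets.

  For \<open>C\<close>, \<open>dF\<close>, \<open>F\<close>, the assessment $(1, 1, 0)$ is coherent, because the three
  prevision values are attained in cases that can be ranked: $AH\overline{K}$ satisfies $A|H$ and
  makes both other objects void; $\overline{A}H\overline{B}K$ makes $B|K$ false and the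
  iterated conditional void; and $AHBK$ makes the iterated conditional true. Given any set
  of bets, the first of these cases whose object is in the set produces gain 0. The point is that
  these three iterated conditionals are void where $\overline{A}H\overline{B}K$ holds: there is
  a case refuting $B|K$, of zero probability given $H$, to which they are insensitive.
\<close>

section \<open>Coherence through single cases\<close>

lemma finite_range_comp2:
  assumes "finite (range f)" "finite (range g)"
  shows "finite (range (\<lambda>w. h (f w) (g w)))"
proof (rule finite_subset)
  show "range (\<lambda>w. h (f w) (g w)) \<subseteq> (\<lambda>(a, b). h a b) ` (range f \<times> range g)"
    by auto
qed (use assms in auto)

lemma finite_range_cond_val: "finite (range (cond_val E H p))"
  by (rule finite_subset[of _ "{0, 1, p}"]) (auto simp: cond_val_def indicator_def)

lemma finite_range_gs_val: "finite (range (gs_val A H B K x y z))"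
  by (rule finite_subset[of _ "{0, 1, x, y, z}"]) (auto simp: gs_val_def indicator_def)

lemma finite_range_conj_val: "finite (range (conj_val i A H B K x y z))"
  by (cases i) (auto simp: finite_range_cond_val finite_range_gs_val)

lemma finite_range_crq_val: "finite (range (crq_val P X))"
proof (cases X)
  case (Iter i A H B K)
  show ?thesis
    unfolding Iter crq_val.simps iter_val_def
    by (rule finite_range_comp2[where h = "\<lambda>c a. c + P (Iter i A H B K) * (1 - a)",
          OF finite_range_conj_val finite_range_cond_val])
qed (auto simp: finite_range_cond_val finite_range_gs_val)

lemma finite_range_gain:
  assumes "finite J"
  shows "finite (range (gain P J s))"
  using assms
proof induction
  case empty
  then show ?case by (simp add: gain_def)
next
  case (insert X J)
  have "gain P (insert X J) s = (\<lambda>w. s X * (crq_val P X w - P X) + gain P J s w)"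
    using insert by (simp add: gain_def fun_eq_iff)
  then show ?case
    using finite_range_comp2[where h = "\<lambda>v g. s X * (v - P X) + g",
        OF finite_range_crq_val insert.IH] by simp
qed

lemma finite_gain_image:
  assumes "finite J"
  shows "finite (gain P J s ` S)"
  using finite_subset[OF _ finite_range_gain[OF assms]] by blast

text \<open>The criterion used for all coherence proofs: it replaces the search for a probability under
  which the gain has mean 0 by a single case in which each bet separately breaks even.\<close>

lemma betting_coherentI:
  assumes "finite F"
    and break_even: "\<And>J. J \<subseteq> F \<Longrightarrow> J \<noteq> {} \<Longrightarrow> \<exists>w\<in>active P J. \<forall>X\<in>J. crq_val P X w = P X"
  shows "betting_coherent F P"
  unfolding betting_coherent_def
proof (intro allI impI)
  fix J s
  assume J: "J \<subseteq> F" "J \<noteq> {}"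
  then obtain w where w: "w \<in> active P J" "\<forall>X\<in>J. crq_val P X w = P X"
    using break_even by blast
  have "gain P J s w = 0"
    using w by (simp add: gain_def)
  then have zero: "0 \<in> gain P J s ` active P J"
    using w by (metis imageI)
  have "finite (gain P J s ` active P J)"
    using J assms(1) by (meson finite_gain_image finite_subset)
  then show "Min (gain P J s ` active P J) \<le> 0 \<and> Max (gain P J s ` active P J) \<ge> 0"
    using zero by simp
qed

lemma betting_coherent_gain_le_0:
  assumes "betting_coherent F P" "J \<subseteq> F" "J \<noteq> {}" "finite J" "active P J \<noteq> {}"
  shows "\<exists>w\<in>active P J. gain P J s w \<le> 0"
proof -
  have "Min (gain P J s ` active P J) \<in> gain P J s ` active P J"
    using assms by (intro Min_in finite_gain_image) auto
  moreover have "Min (gain P J s ` active P J) \<le> 0"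
    using assms unfolding betting_coherent_def by blast
  ultimately show ?thesis by auto
qed

lemma betting_coherent_gain_ge_0:
  assumes "betting_coherent F P" "J \<subseteq> F" "J \<noteq> {}" "finite J" "active P J \<noteq> {}"
  shows "\<exists>w\<in>active P J. gain P J s w \<ge> 0"
proof -
  have "gain P J (\<lambda>X. - s X) w = - gain P J s w" for w
    by (simp add: gain_def sum_negf)
  then show ?thesis
    using betting_coherent_gain_le_0[OF assms, of "\<lambda>X. - s X"] by simp
qed

text \<open>Meant for a case \<open>w\<close> in which $AHBK$ is true, a common success of all the objects.\<close>

lemma betting_coherent_all_1:
  assumes "finite F"
    and "\<And>X. X \<in> F \<Longrightarrow> crq_val (\<lambda>_. 1) X w = 1"
    and "\<And>X. X \<in> F \<Longrightarrow> \<not> called_off (\<lambda>_. 1) X w"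
  shows "betting_coherent F (\<lambda>_. 1)"
  using assms by (intro betting_coherentI bexI[of _ w]) (auto simp: active_def)

section \<open>Iterated conditionals built from a conjunction\<close>

lemma conj_val_all_true:
  assumes "w \<in> A \<inter> H \<inter> B \<inter> K"
  shows "conj_val i A H B K x y z w = 1"
  using assms
  by (cases i) (auto simp: cond_val_def gs_val_def conj_cond_K_def conj_cond_L_def indicator_def)

lemma crq_val_cond_conj:
  "crq_val P (cond_conj i A H B K) w =
     conj_val i A H B K (P (CondEvent A H)) (P (CondEvent B K)) (P (cond_conj i A H B K)) w"
  by (cases i) auto

lemma called_off_cond_conj_all_true:
  assumes "w \<in> A \<inter> H \<inter> B \<inter> K"
  shows "\<not> called_off P (cond_conj i A H B K) w"
  using assms by (cases i) (auto simp: conj_cond_K_def conj_cond_L_def)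

lemma iter_val_all_true:
  assumes "w \<in> A \<inter> H \<inter> B \<inter> K"
  shows "iter_val i A H B K x y z m w = 1"
  using assms by (auto simp: iter_val_def conj_val_all_true cond_val_def)

lemma called_off_Iter_all_true:
  assumes "w \<in> A \<inter> H \<inter> B \<inter> K"
  shows "\<not> called_off P (Iter i A H B K) w"
  using assms by (auto simp: iter_val_all_true intro: exI[of _ 0])

lemma p_consistent_Iter:
  assumes "A \<inter> H \<inter> B \<inter> K \<noteq> {}"
  shows "p_consistent {CondEvent A H, Iter i A H B K}"
proof -
  obtain w where w: "w \<in> A \<inter> H \<inter> B \<inter> K"
    using assms by blast
  have "betting_coherent
      {CondEvent A H, Iter i A H B K, CondEvent B K, cond_conj i A H B K} (\<lambda>_. 1)"
  proof (rule betting_coherent_all_1)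
    fix X
    assume X: "X \<in> {CondEvent A H, Iter i A H B K, CondEvent B K, cond_conj i A H B K}"
    show "crq_val (\<lambda>_. 1) X w = 1"
      using X w
      by (auto simp: crq_val_cond_conj conj_val_all_true iter_val_all_true cond_val_def)
    show "\<not> called_off (\<lambda>_. 1) X w"
      using X w called_off_cond_conj_all_true[OF w] called_off_Iter_all_true[OF w]
      by (auto simp del: called_off.simps(3))
  qed simp
  moreover have "{CondEvent A H, Iter i A H B K} \<union>
      (\<Union>X\<in>{CondEvent A H, Iter i A H B K}. constituents X) =
      {CondEvent A H, Iter i A H B K, CondEvent B K, cond_conj i A H B K}"
    by auto
  ultimately show ?thesis
    unfolding p_consistent_def coherent_def by auto
qed

text \<open>The compound prevision theorem: whatever the conjunction is, paying $m$ for the iterated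
  conditional, selling the conjunction and buying $m$ units of $A|H$ gives the gain $z - xm$ in
  every case.\<close>

lemma conj_prevision_eq_product:
  assumes coh: "betting_coherent F Q"
    and sub: "{CondEvent A H, Iter i A H B K, cond_conj i A H B K} \<subseteq> F"
    and ne: "CondEvent A H \<noteq> cond_conj i A H B K" and true: "A \<inter> H \<inter> B \<inter> K \<noteq> {}"
  shows "Q (cond_conj i A H B K) = Q (CondEvent A H) * Q (Iter i A H B K)"
proof -
  let ?a = "CondEvent A H" and ?t = "Iter i A H B K" and ?c = "cond_conj i A H B K"
  let ?J = "{?a, ?t, ?c}"
  let ?s = "\<lambda>X. if X = ?a then Q ?t else if X = ?t then 1 else - 1 :: real"
  have ne': "?t \<noteq> ?c"
    by (cases i) auto
  have gain: "gain Q ?J ?s w = Q ?c - Q ?a * Q ?t" for w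
    using ne ne' by (simp add: gain_def crq_val_cond_conj iter_val_def algebra_simps)
  obtain w where "w \<in> A \<inter> H \<inter> B \<inter> K"
    using true by blast
  then have act: "active Q ?J \<noteq> {}"
    by (auto simp: active_def)
  have J: "?J \<noteq> {}" "finite ?J"
    by auto
  show ?thesis
    using betting_coherent_gain_le_0[OF coh sub J act, of ?s]
      betting_coherent_gain_ge_0[OF coh sub J act, of ?s]
    unfolding gain by auto
qed

lemma prevision_cond_event_le_1:
  assumes coh: "betting_coherent F Q" and "CondEvent B K \<in> F" "K \<noteq> {}"
  shows "Q (CondEvent B K) \<le> 1"
proof -
  have "active Q {CondEvent B K} = K"
    by (auto simp: active_def)
  then obtain w where "w \<in> K" "gain Q {CondEvent B K} (\<lambda>_. 1) w \<ge> 0"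
    using betting_coherent_gain_ge_0[OF coh, of "{CondEvent B K}" "\<lambda>_. 1"] assms by auto
  then show ?thesis
    by (cases "w \<in> B") (auto simp: gain_def cond_val_def)
qed

text \<open>Selling $|y|+1$ units of the conjunction outweighs the loss $y$ on $B|K$ in the cases where
  the conjunction is false, and costs nothing elsewhere.
  The hypothesis $x = 1$ serves the index \<open>gs\<close>, where in the case $\overline{H}BK$ the
  conjunction is worth $x$ and selling it must not lose.\<close>

lemma prevision_conjunct_eq_1:
  assumes coh: "betting_coherent F Q"
    and sub: "{CondEvent B K, cond_conj i A H B K} \<subseteq> F"
    and ne: "CondEvent B K \<noteq> cond_conj i A H B K" and true: "A \<inter> H \<inter> B \<inter> K \<noteq> {}"
    and x: "Q (CondEvent A H) = 1" and z: "Q (cond_conj i A H B K) = 1"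
  shows "Q (CondEvent B K) = 1"
proof (rule antisym)
  let ?b = "CondEvent B K" and ?c = "cond_conj i A H B K"
  let ?J = "{?b, ?c}" and ?y = "Q (CondEvent B K)"
  let ?s = "\<lambda>X. if X = ?b then 1 else - (\<bar>?y\<bar> + 1)"
  show "?y \<le> 1"
    using sub true by (intro prevision_cond_event_le_1[OF coh]) auto
  show "1 \<le> ?y"
  proof (rule ccontr)
    assume "\<not> 1 \<le> ?y"
    then have y: "?y < 1" by simp
    have act: "active Q ?J \<noteq> {}"
      using true by (auto simp: active_def)
    have J: "?J \<noteq> {}" "finite ?J"
      by auto
    obtain w where w: "w \<in> active Q ?J" "gain Q ?J ?s w \<le> 0"
      using betting_coherent_gain_le_0[OF coh sub J act, of ?s] by blast
    define c where "c = conj_val i A H B K 1 ?y 1 w"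
    have gain: "gain Q ?J ?s w = (cond_val B K ?y w - ?y) + (\<bar>?y\<bar> + 1) * (1 - c)"
      using ne ne[symmetric] x z by (simp add: gain_def c_def crq_val_cond_conj algebra_simps)
    have on: "w \<in> K \<or> \<not> called_off Q ?c w"
      using w(1) by (auto simp: active_def)
    have "c \<le> 1"
      using y unfolding c_def by (cases i) (auto simp: cond_val_def gs_val_def indicator_def)
    then have nonneg: "0 \<le> (\<bar>?y\<bar> + 1) * (1 - c)"
      by simp
    have "0 < (cond_val B K ?y w - ?y) + (\<bar>?y\<bar> + 1) * (1 - c)"
    proof (cases "w \<in> K")
      case True
      show ?thesis
      proof (cases "w \<in> B")
        case True
        then have "cond_val B K ?y w = 1"
          using \<open>w \<in> K\<close> by (simp add: cond_val_def)
        then show ?thesis using y nonneg by linarith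
      next
        case False
        then have "cond_val B K ?y w = 0" "c = 0"
          using \<open>w \<in> K\<close> unfolding c_def
          by (cases i; auto simp: cond_val_def gs_val_def conj_cond_K_def conj_cond_L_def)+
        then show ?thesis by simp
      qed
    next
      case False
      then have "c < 1"
        using on y unfolding c_def
        by (cases i) (auto simp: cond_val_def gs_val_def conj_cond_K_def conj_cond_L_def
            indicator_def)
      then have "0 < (\<bar>?y\<bar> + 1) * (1 - c)"
        by (intro mult_pos_pos) auto
      then show ?thesis
        using False by (simp add: cond_val_def)
    qed
    then show False
      using w(2) gain by linarith
  qed
qed

lemma p_entails_Iter:
  assumes indep: "logically_independent A B H K"
  shows "p_entails {CondEvent A H, Iter i A H B K} (CondEvent B K)"
proof -
  have true: "A \<inter> H \<inter> B \<inter> K \<noteq> {}"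
    using indep unfolding logically_independent_def by auto
  have "A \<inter> - B \<noteq> {}" "- A \<inter> B \<noteq> {}"
    using indep unfolding logically_independent_def by blast+
  then have "CondEvent A H \<noteq> cond_conj i A H B K" "CondEvent B K \<noteq> cond_conj i A H B K"
    by (cases i; auto)+
  note ne = this
  have "P (CondEvent B K) = 1"
    if coh: "coherent ({CondEvent A H, Iter i A H B K} \<union> {CondEvent B K}) P"
      and P: "\<forall>Y\<in>{CondEvent A H, Iter i A H B K}. P Y = 1" for P
  proof -
    let ?F = "{CondEvent A H, Iter i A H B K} \<union> {CondEvent B K}"
    let ?G = "?F \<union> (\<Union>X\<in>?F. constituents X)"
    obtain Q where Q: "\<forall>X\<in>?F. Q X = P X" and bc: "betting_coherent ?G Q"
      using coh unfolding coherent_def by blast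
    have Q1: "Q (CondEvent A H) = 1" "Q (Iter i A H B K) = 1"
      using Q P by auto
    have "Q (cond_conj i A H B K) = Q (CondEvent A H) * Q (Iter i A H B K)"
      by (rule conj_prevision_eq_product[OF bc _ ne(1) true]) auto
    then have "Q (CondEvent B K) = 1"
      using Q1 by (intro prevision_conjunct_eq_1[OF bc _ ne(2) true]) auto
    then show ?thesis
      using Q by simp
  qed
  then show ?thesis
    unfolding p_entails_def using p_consistent_Iter[OF true] by blast
qed

section \<open>Iterated conditionals that are conditional events\<close>

lemma p_consistent_cond_events:
  assumes "E \<inter> H \<inter> (E' \<inter> H') \<noteq> {}"
  shows "p_consistent {CondEvent E H, CondEvent E' H'}"
proof -
  obtain w where "w \<in> E \<inter> H \<inter> (E' \<inter> H')"
    using assms by blast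
  then have "betting_coherent {CondEvent E H, CondEvent E' H'} (\<lambda>_. 1)"
    by (intro betting_coherent_all_1[of _ w]) (auto simp: cond_val_def)
  then show ?thesis
    unfolding p_consistent_def coherent_def by auto
qed

text \<open>The assessment $(1, 1, 0)$ is coherent by a ranking of three cases: \<open>u\<close> serves the
  sets of bets that contain $A|H$, \<open>v\<close> those that contain $B|K$ but not $A|H$, and \<open>w\<close> the
  remaining one.\<close>

lemma not_p_entails_cond_events:
  assumes u: "u \<in> A \<inter> H" "u \<notin> K" "u \<notin> D"
    and v: "v \<notin> B" "v \<in> K" "v \<notin> D"
    and w: "w \<in> E \<inter> D"
  shows "\<not> p_entails {CondEvent A H, CondEvent E D} (CondEvent B K)"
proof -
  let ?F = "{CondEvent A H, CondEvent E D, CondEvent B K}"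
  define P :: "'a crq \<Rightarrow> real" where "P = (\<lambda>X. if X = CondEvent B K then 0 else 1)"
  have P: "P (CondEvent A H) = 1" "P (CondEvent E D) = 1" "P (CondEvent B K) = 0"
    using u v by (auto simp: P_def)
  have "betting_coherent ?F P"
  proof (rule betting_coherentI)
    fix J
    assume J: "J \<subseteq> ?F" "J \<noteq> {}"
    consider "CondEvent A H \<in> J" | "CondEvent A H \<notin> J" "CondEvent B K \<in> J"
      | "J = {CondEvent E D}"
      using J by blast
    then show "\<exists>w\<in>active P J. \<forall>X\<in>J. crq_val P X w = P X"
    proof cases
      case 1
      have "u \<in> active P J"
        using 1 u by (auto simp: active_def intro!: bexI[of _ "CondEvent A H"])
      moreover have "\<forall>X\<in>J. crq_val P X u = P X"
        using J(1) u P by (auto simp: cond_val_def)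
      ultimately show ?thesis by blast
    next
      case 2
      have "v \<in> active P J"
        using 2 v by (auto simp: active_def intro!: bexI[of _ "CondEvent B K"])
      moreover have "\<forall>X\<in>J. crq_val P X v = P X"
        using J(1) 2 v P by (auto simp: cond_val_def)
      ultimately show ?thesis by blast
    next
      case 3
      have "w \<in> active P J" "\<forall>X\<in>J. crq_val P X w = P X"
        using 3 w P by (simp_all add: active_def cond_val_def)
      then show ?thesis by blast
    qed
  qed simp
  moreover have "{CondEvent A H, CondEvent E D} \<union> {CondEvent B K} = ?F"
    by blast
  ultimately have "coherent ({CondEvent A H, CondEvent E D} \<union> {CondEvent B K}) P"
    unfolding coherent_def by auto
  then show ?thesis
    using P unfolding p_entails_def by fastforce
qed

theorem mainTheorem17:
  fixes A B H K :: "'w set"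
  assumes "logically_independent A B H K"
  shows "(\<forall>i \<in> {It_C, It_dF, It_F, It_K, It_L, It_gs}.
            p_consistent {CondEvent A H, iterated i A H B K})
       \<and> (\<forall>i \<in> {It_K, It_L, It_gs}.
            p_entails {CondEvent A H, iterated i A H B K} (CondEvent B K))
       \<and> (\<forall>i \<in> {It_C, It_dF, It_F}.
            \<not> p_entails {CondEvent A H, iterated i A H B K} (CondEvent B K))"
proof -
  have true: "A \<inter> H \<inter> B \<inter> K \<noteq> {}"
    using assms unfolding logically_independent_def by auto
  have "A \<inter> B \<inter> H \<inter> - K \<noteq> {}" "- A \<inter> - B \<inter> H \<inter> K \<noteq> {}"
    using assms unfolding logically_independent_def by blast+
  then obtain u v where u: "u \<in> A \<inter> B \<inter> H \<inter> - K" and v: "v \<in> - A \<inter> - B \<inter> H \<inter> K"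
    by blast
  obtain w where w: "w \<in> A \<inter> H \<inter> B \<inter> K"
    using true by blast
  have "p_consistent {CondEvent A H, iterated i A H B K}" for i
  proof (cases i)
    case It_C
    show ?thesis unfolding It_C iterated.simps
      by (rule p_consistent_cond_events) (use w in auto)
  next
    case It_dF
    show ?thesis unfolding It_dF iterated.simps
      by (rule p_consistent_cond_events) (use w in auto)
  next
    case It_F
    show ?thesis unfolding It_F iterated.simps
      by (rule p_consistent_cond_events) (use w in auto)
  qed (simp_all add: p_consistent_Iter[OF true])
  moreover have "p_entails {CondEvent A H, iterated i A H B K} (CondEvent B K)"
    if "i \<in> {It_K, It_L, It_gs}" for i
    using that p_entails_Iter[OF assms] by auto
  moreover have "\<not> p_entails {CondEvent A H, iterated i A H B K} (CondEvent B K)"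
    if "i \<in> {It_C, It_dF, It_F}" for i
  proof -
    consider "i = It_C" | "i = It_dF" | "i = It_F"
      using \<open>i \<in> _\<close> by blast
    then show ?thesis
    proof cases
      case 1
      show ?thesis unfolding 1 iterated.simps
        by (rule not_p_entails_cond_events[of u _ _ _ _ v _ w]) (use u v w in auto)
    next
      case 2
      show ?thesis unfolding 2 iterated.simps
        by (rule not_p_entails_cond_events[of u _ _ _ _ v _ w]) (use u v w in auto)
    next
      case 3
      show ?thesis unfolding 3 iterated.simps
        by (rule not_p_entails_cond_events[of u _ _ _ _ v _ w]) (use u v w in auto)
    qed
  qed
  ultimately show ?thesis by simp
qed

end
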